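(* The group $$G=\langle x,y\mid x^2=y^3=((xy)^3(xy^2)^2xy(xy^2)^2xyxy^2)^2=1\rangle$$ contains non-abelian free subgroups. *)

theory Defs
  imports "HOL-Algebra.Coset" "HOL-Algebra.Generated_Groups"
begin

text \<open>
  A letter \<open>(True, a)\<close> stands for the generator \<open>a\<close>, and \<open>(False, a)\<close> for its formal
  inverse. The free group on \<open>X\<close> consists of the reduced words over \<open>X\<close>, multiplied by
  concatenation followed by free reduction.
\<close>

type_synonym 'a word = "(bool \<times> 'a) list"

definition inv_letter :: "bool \<times> 'a \<Rightarrow> bool \<times> 'a" where
  "inv_letter l = (\<not> fst l, snd l)"

definition reduced :: "'a word \<Rightarrow> bool" where
  "reduced w \<longleftrightarrow> (\<forall>i. Suc i < length w \<longrightarrow> w ! Suc i \<noteq> inv_letter (w ! i))"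

fun push :: "bool \<times> 'a \<Rightarrow> 'a word \<Rightarrow> 'a word" where
  "push l [] = [l]"
| "push l (m # w) = (if m = inv_letter l then w else l # m # w)"

definition free_reduce :: "'a word \<Rightarrow> 'a word" where
  "free_reduce w = foldr push w []"

definition free_group :: "'a set \<Rightarrow> 'a word monoid" where
  "free_group X =
     \<lparr>carrier = {w. reduced w \<and> snd ` set w \<subseteq> X},
      mult = (\<lambda>u v. free_reduce (u @ v)),
      one = []\<rparr>"

lemma inv_letter_inv [simp]: "inv_letter (inv_letter l) = l"
  by (simp add: inv_letter_def)

lemma inv_letter_neq [simp]: "inv_letter l \<noteq> l"
  by (cases l) (simp add: inv_letter_def)

lemma snd_inv_letter [simp]: "snd (inv_letter l) = snd l"
  by (simp add: inv_letter_def)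

lemma reduced_Nil [simp]: "reduced []"
  by (simp add: reduced_def)

lemma reduced_single [simp]: "reduced [l]"
  by (simp add: reduced_def)

lemma reduced_Cons_Cons [simp]:
  "reduced (l # m # w) \<longleftrightarrow> m \<noteq> inv_letter l \<and> reduced (m # w)"
  unfolding reduced_def by (auto simp: nth_Cons split: nat.splits)

lemma reduced_tl: "reduced (l # w) \<Longrightarrow> reduced w"
  by (cases w) auto

lemma reduced_push: "reduced w \<Longrightarrow> reduced (push l w)"
  by (cases w) (auto dest: reduced_tl)

lemma reduced_foldr_push: "reduced w \<Longrightarrow> reduced (foldr push u w)"
  by (induction u) (auto intro: reduced_push)

lemma push_push_inv: "reduced w \<Longrightarrow> push l (push (inv_letter l) w) = w"
  by (induction w rule: induct_list012) auto

lemma free_reduce_reduced: "reduced w \<Longrightarrow> free_reduce w = w"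
  unfolding free_reduce_def by (induction w rule: induct_list012) auto

lemma foldr_push_push:
  assumes "reduced w"
  shows "foldr push (push l u) w = push l (foldr push u w)"
proof (cases u)
  case Nil
  then show ?thesis by simp
next
  case (Cons m v)
  have "reduced (foldr push v w)" using assms by (rule reduced_foldr_push)
  then show ?thesis using Cons by (auto simp: push_push_inv)
qed

lemma foldr_push_foldr_push:
  "reduced w \<Longrightarrow> foldr push (foldr push u v) w = foldr push u (foldr push v w)"
  by (induction u) (auto simp: foldr_push_push)

lemma free_reduce_append: "reduced v \<Longrightarrow> free_reduce (u @ v) = foldr push u v"
  using free_reduce_reduced[of v] by (simp add: free_reduce_def)

lemma letters_foldr_push: "set (foldr push u w) \<subseteq> set u \<union> set w"
proof (induction u)
  case (Cons l u)
  have "set (push l v) \<subseteq> insert l (set v)" for v :: "'a word"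
    by (cases v) auto
  from this[of "foldr push u w"] show ?case using Cons by auto
qed simp

lemma inverse_word:
  "reduced w \<Longrightarrow> foldr push (map inv_letter (rev w)) w = []"
proof (induction w)
  case (Cons l w)
  then show ?case by (auto dest: reduced_tl)
qed simp

lemma reduced_inverse: "reduced w \<Longrightarrow> reduced (map inv_letter (rev w))"
  unfolding reduced_def
proof (intro allI impI)
  fix i
  assume red: "\<forall>i. Suc i < length w \<longrightarrow> w ! Suc i \<noteq> inv_letter (w ! i)"
    and i: "Suc i < length (map inv_letter (rev w))"
  define j where "j = length w - Suc (Suc i)"
  have j: "Suc j < length w" "length w - Suc i = Suc j" using i by (auto simp: j_def)
  with red have "w ! Suc j \<noteq> inv_letter (w ! j)" by blast
  then have "inv_letter (w ! j) \<noteq> w ! Suc j" by metis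
  then show "map inv_letter (rev w) ! Suc i \<noteq> inv_letter (map inv_letter (rev w) ! i)"
    using i j by (simp add: rev_nth j_def[symmetric])
qed

lemma group_free_group: "group (free_group X)"
proof (rule groupI)
  fix u v assume "u \<in> carrier (free_group X)" "v \<in> carrier (free_group X)"
  then show "u \<otimes>\<^bsub>free_group X\<^esub> v \<in> carrier (free_group X)"
    using letters_foldr_push[of u v]
    by (fastforce simp: free_group_def free_reduce_append intro: reduced_foldr_push)
next
  fix u v w
  assume "u \<in> carrier (free_group X)" "v \<in> carrier (free_group X)" "w \<in> carrier (free_group X)"
  then show "u \<otimes>\<^bsub>free_group X\<^esub> v \<otimes>\<^bsub>free_group X\<^esub> w = u \<otimes>\<^bsub>free_group X\<^esub> (v \<otimes>\<^bsub>free_group X\<^esub> w)"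
    by (simp add: free_group_def free_reduce_append reduced_foldr_push foldr_push_foldr_push)
next
  fix u assume u: "u \<in> carrier (free_group X)"
  then have "map inv_letter (rev u) \<in> carrier (free_group X)"
    by (auto simp: free_group_def reduced_inverse image_image)
  moreover have "map inv_letter (rev u) \<otimes>\<^bsub>free_group X\<^esub> u = \<one>\<^bsub>free_group X\<^esub>"
    using u by (simp add: free_group_def free_reduce_append inverse_word)
  ultimately show "\<exists>v\<in>carrier (free_group X). v \<otimes>\<^bsub>free_group X\<^esub> u = \<one>\<^bsub>free_group X\<^esub>"
    by blast
qed (simp_all add: free_group_def free_reduce_reduced)

text \<open>
  The index set of a free basis may be taken inside the element type of \<open>G\<close>, since a basis of
  \<open>G\<close> is a set of elements of \<open>G\<close>. The trivial group is free, on the empty set.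
\<close>

definition is_free_group :: "('a, 'b) monoid_scheme \<Rightarrow> bool" where
  "is_free_group G \<longleftrightarrow> group G \<and> (\<exists>X :: 'a set. free_group X \<cong> G)"

definition normal_closure :: "('a, 'b) monoid_scheme \<Rightarrow> 'a set \<Rightarrow> 'a set" where
  "normal_closure G R = \<Inter> {N. N \<lhd> G \<and> R \<subseteq> N}"

definition presented_group :: "'a set \<Rightarrow> 'a word set \<Rightarrow> 'a word set monoid" where
  "presented_group X R = free_group X Mod normal_closure (free_group X) R"

definition gen :: "'a \<Rightarrow> 'a word" where
  "gen a = [(True, a)]"

lemma gen_in_carrier [simp]: "a \<in> X \<Longrightarrow> gen a \<in> carrier (free_group X)"
  by (simp add: gen_def free_group_def)

lemma (in group) normal_closure_normal:
  assumes "R \<subseteq> carrier G"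
  shows "normal_closure G R \<lhd> G"
proof -
  have self: "carrier G \<lhd> G"
    by (rule normal_invI) (auto intro: subgroup_self)
  let ?S = "{N. N \<lhd> G \<and> R \<subseteq> N}"
  have mem: "carrier G \<in> ?S" using self assms by simp
  show ?thesis unfolding normal_closure_def
  proof (rule normal_invI)
    show "subgroup (\<Inter> ?S) G"
      using mem by (intro subgroups_Inter) (auto simp: normal_imp_subgroup)
  next
    fix g h assume "g \<in> carrier G" "h \<in> \<Inter> ?S"
    then show "g \<otimes> h \<otimes> inv g \<in> \<Inter> ?S"
      by (auto simp: normal_inv_iff)
  qed
qed

lemma group_presented_group:
  "R \<subseteq> carrier (free_group X) \<Longrightarrow> group (presented_group X R)"
  unfolding presented_group_def
  by (intro normal.factorgroup_is_group group.normal_closure_normal group_free_group)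

datatype generator = Gen_x | Gen_y

definition relators :: "generator word set" where
  "relators =
    (let F = free_group (UNIV :: generator set); x = gen Gen_x; y = gen Gen_y in
      {x [^]\<^bsub>F\<^esub> (2::nat),
       y [^]\<^bsub>F\<^esub> (3::nat),
       ((x \<otimes>\<^bsub>F\<^esub> y) [^]\<^bsub>F\<^esub> (3::nat)
         \<otimes>\<^bsub>F\<^esub> (x \<otimes>\<^bsub>F\<^esub> y [^]\<^bsub>F\<^esub> (2::nat)) [^]\<^bsub>F\<^esub> (2::nat)
         \<otimes>\<^bsub>F\<^esub> x \<otimes>\<^bsub>F\<^esub> y
         \<otimes>\<^bsub>F\<^esub> (x \<otimes>\<^bsub>F\<^esub> y [^]\<^bsub>F\<^esub> (2::nat)) [^]\<^bsub>F\<^esub> (2::nat)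
         \<otimes>\<^bsub>F\<^esub> x \<otimes>\<^bsub>F\<^esub> y \<otimes>\<^bsub>F\<^esub> x \<otimes>\<^bsub>F\<^esub> y [^]\<^bsub>F\<^esub> (2::nat)) [^]\<^bsub>F\<^esub> (2::nat)})"

definition Gxy :: "generator word set monoid" where
  "Gxy = presented_group UNIV relators"

lemma relators_in_carrier: "relators \<subseteq> carrier (free_group UNIV)"
proof -
  interpret group "free_group (UNIV :: generator set)" by (rule group_free_group)
  show ?thesis by (simp add: relators_def Let_def)
qed

lemma group_Gxy: "group Gxy"
  unfolding Gxy_def by (intro group_presented_group relators_in_carrier)

end

theory Submission
  imports Defs "HOL-Analysis.Product_Vector"
begin

text \<open>
  The subgroup of index three in \<open>G\<close> generated by the involutions \<open>a = x\<close>, \<open>b = y x y\<^sup>-\<^sup>1\<close>,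
  \<open>c = y\<^sup>-\<^sup>1 x y\<close> is defined by \<open>a\<^sup>2 = b\<^sup>2 = c\<^sup>2 = 1\<close> and \<open>(abcacbcbab)\<^sup>2 = 1\<close> together with the
  two cyclic shifts of the last relation along \<open>a \<mapsto> b \<mapsto> c\<close>. Homomorphisms of \<open>\<langle>a, b, c | a\<^sup>2, b\<^sup>2, c\<^sup>2\<rangle>\<close>
  to \<open>PSL\<^sub>2\<close> that kill none of \<open>a, b, c\<close> depend on three parameters, and each remaining relation is
  one equation (a vanishing trace), so isolated solutions are to be expected. One of them is defined
  over a real field of degree six and preserves a form of signature (2,1). Three conjugates of \<open>b\<close>
  then act as reflections in pairwise disjoint hyperbolic lines and generate a free product of
  three groups of order two by ping-pong; its even subgroup is free of rank two.
\<close>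

section \<open>The field and its integers\<close>

text \<open>
  If \<open>u\<close>, \<open>v\<close>, \<open>w\<close> are the negated traces of \<open>ab\<close>, \<open>bc\<close>, \<open>ca\<close>, the trace equations are satisfied when
  \<open>u v w = \<kappa>\<close> and \<open>u\<^sup>2\<close>, \<open>v\<^sup>2\<close>, \<open>w\<^sup>2\<close> are the three roots of \<open>cubic\<close>, in a suitable cyclic order.
  The root \<open>\<xi> = u\<^sup>2\<close> is positive and the other two are negative.
\<close>

definition kappa :: real where
  "kappa = (1 - sqrt 5) / 2"

lemma kappa_square: "kappa * kappa = kappa + 1"
  by (simp add: kappa_def field_simps)

lemma kappa_bounds: "- 0.6181 < kappa" "kappa < - 0.618"
proof -
  have "sqrt 5 < 2.2362" by (rule real_less_lsqrt) (auto simp: power2_eq_square)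
  then show "- 0.6181 < kappa" by (simp add: kappa_def)
  have "2.236 < sqrt 5" by (rule real_less_rsqrt) (auto simp: power2_eq_square)
  then show "kappa < - 0.618" by (simp add: kappa_def)
qed

definition cubic :: "real \<Rightarrow> real" where
  "cubic x = x ^ 3 - 3 * kappa * x ^ 2 + (6 * kappa - 3) * x - (kappa + 1)"

lemma ex_root_cubic: "\<exists>x. 1.86 \<le> x \<and> x \<le> 1.862 \<and> cubic x = 0"
proof (rule IVT)
  show "cubic 1.86 \<le> 0" "0 \<le> cubic 1.862"
    using kappa_bounds by (simp_all add: cubic_def power2_eq_square power3_eq_cube field_simps)
qed (auto simp: cubic_def intro!: continuous_intros)

definition xi :: real where
  "xi = (SOME x. 1.86 \<le> x \<and> x \<le> 1.862 \<and> cubic x = 0)"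

lemma xi_bounds: "1.86 \<le> xi" "xi \<le> 1.862" and cubic_xi: "cubic xi = 0"
  using someI_ex[OF ex_root_cubic] unfolding xi_def by blast+

lemma xi_cube: "xi ^ 3 = 3 * kappa * xi ^ 2 + (3 - 6 * kappa) * xi + (kappa + 1)"
  using cubic_xi by (simp add: cubic_def algebra_simps)

text \<open>Exact arithmetic in the ring generated by \<kappa> and \<xi>: a pair stands for a + b
  \<kappa>, a triple lists the coefficients of 1, \<xi>, \<xi>^2. Identities in this ring then
  become integer evaluations.\<close>

type_synonym quad = "int \<times> int"
type_synonym num = "quad \<times> quad \<times> quad"

fun qadd :: "quad \<Rightarrow> quad \<Rightarrow> quad" where
  "qadd (a, b) (c, d) = (a + c, b + d)"

fun qmul :: "quad \<Rightarrow> quad \<Rightarrow> quad" where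
  "qmul (a, b) (c, d) = (a * c + b * d, a * d + b * c + b * d)"

fun nadd :: "num \<Rightarrow> num \<Rightarrow> num" where
  "nadd (a, b, c) (a', b', c') = (qadd a a', qadd b b', qadd c c')"

fun nneg :: "num \<Rightarrow> num" where
  "nneg ((a, b), (c, d), (e, f)) = ((- a, - b), (- c, - d), (- e, - f))"

text \<open>The constants are the coefficients of \<open>\<xi>\<^sup>3\<close> and \<open>\<xi>\<^sup>4\<close> as combinations of 1, \<open>\<xi>\<close>, \<open>\<xi>\<^sup>2\<close>.\<close>

fun nred :: "quad \<Rightarrow> quad \<Rightarrow> quad \<Rightarrow> quad \<Rightarrow> quad \<Rightarrow> num" where
  "nred r0 r1 r2 r3 r4 =
     (qadd r0 (qadd (qmul r3 (1, 1)) (qmul r4 (3, 6))),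
      qadd r1 (qadd (qmul r3 (3, - 6)) (qmul r4 (- 17, - 8))),
      qadd r2 (qadd (qmul r3 (0, 3)) (qmul r4 (12, 3))))"

fun nmul :: "num \<Rightarrow> num \<Rightarrow> num" where
  "nmul (a, b, c) (a', b', c') =
     nred (qmul a a') (qadd (qmul a b') (qmul b a'))
       (qadd (qmul a c') (qadd (qmul b b') (qmul c a')))
       (qadd (qmul b c') (qmul c b')) (qmul c c')"

fun qval :: "quad \<Rightarrow> real" where
  "qval (a, b) = of_int a + of_int b * kappa"

fun nval :: "num \<Rightarrow> real" where
  "nval (a, b, c) = qval a + qval b * xi + qval c * xi ^ 2"

lemma qval_qadd [simp]: "qval (qadd p q) = qval p + qval q"
  by (cases p; cases q) (simp add: algebra_simps)

lemma qval_qmul [simp]: "qval (qmul p q) = qval p * qval q"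
proof (cases p; cases q)
  fix a b c d assume "p = (a, b)" "q = (c, d)"
  moreover have "of_int b * kappa * (of_int d * kappa) = of_int b * of_int d * (kappa + 1)"
    by (simp flip: kappa_square)
  ultimately show ?thesis by (simp add: algebra_simps)
qed

lemma nval_nadd [simp]: "nval (nadd p q) = nval p + nval q"
  by (cases p; cases q) (simp add: algebra_simps)

lemma nval_nneg [simp]: "nval (nneg p) = - nval p"
  by (cases p) (auto simp: algebra_simps)

lemma nval_nmul [simp]: "nval (nmul p q) = nval p * nval q"
proof (cases p; cases q)
  fix a b c a' b' c' assume pq: "p = (a, b, c)" "q = (a', b', c')"
  have "xi ^ 4 = 3 * kappa * xi ^ 3 + (3 - 6 * kappa) * xi ^ 2 + (kappa + 1) * xi"
    using arg_cong[OF xi_cube, of "\<lambda>t. t * xi"]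
    by (simp add: power2_eq_square power3_eq_cube power4_eq_xxxx algebra_simps)
  then have xi4: "xi ^ 4 = (12 + 3 * kappa) * xi ^ 2 + (- 17 - 8 * kappa) * xi + (3 + 6 * kappa)"
    unfolding xi_cube using kappa_square by algebra
  have "nval p * nval q =
      qval a * qval a' + (qval a * qval b' + qval b * qval a') * xi
      + (qval a * qval c' + (qval b * qval b' + qval c * qval a')) * xi ^ 2
      + (qval b * qval c' + qval c * qval b') * xi ^ 3 + qval c * qval c' * xi ^ 4"
    by (simp add: pq power2_eq_square power3_eq_cube power4_eq_xxxx algebra_simps)
  also have "\<dots> = nval (nmul p q)"
    by (simp add: pq Let_def xi_cube xi4) (simp add: algebra_simps)
  finally show ?thesis by simp
qed

section \<open>Three involutions of a hyperbolic plane\<close>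

type_synonym vec = "real \<times> real \<times> real"
type_synonym nvec = "num \<times> num \<times> num"

text \<open>
  \<open>sa\<close>, \<open>sb\<close>, \<open>sc\<close> are the reflections of the geometric representation for a generalized Cartan matrix
  with \<open>c12 = c23 = 1\<close>, rescaled so that all its entries lie in the ring generated by \<open>\<kappa>\<close> and \<open>\<xi>\<close>:
  \<open>c12 c21 = u\<^sup>2\<close>, \<open>c23 c32 = v\<^sup>2\<close>, \<open>c13 c31 = w\<^sup>2\<close> and \<open>c12 c23 c31 = c21 c32 c13 = \<kappa>\<close>.
\<close>

definition c13 :: num where "c13 = ((4, - 3), (0, 2), (- 1, 0))"
definition c21 :: num where "c21 = ((0, 0), (1, 0), (0, 0))"
definition c31 :: num where "c31 = ((0, 1), (0, 0), (0, 0))"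
definition c32 :: num where "c32 = ((3, 2), (- 3, - 2), (0, 1))"

fun sa sb sc :: "vec \<Rightarrow> vec" where
  "sa (p, q, r) = (- (p + q + nval c13 * r), q, r)"
| "sb (p, q, r) = (p, - (q + nval c21 * p + r), r)"
| "sc (p, q, r) = (p, q, - (r + nval c31 * p + nval c32 * q))"

fun na nb nc :: "nvec \<Rightarrow> nvec" where
  "na (p, q, r) = (nneg (nadd (nadd p q) (nmul c13 r)), q, r)"
| "nb (p, q, r) = (p, nneg (nadd (nadd q (nmul c21 p)) r), r)"
| "nc (p, q, r) = (p, q, nneg (nadd (nadd r (nmul c31 p)) (nmul c32 q)))"

fun vval :: "nvec \<Rightarrow> vec" where
  "vval (p, q, r) = (nval p, nval q, nval r)"

lemma vval_reflections:
  "sa (vval v) = vval (na v)" "sb (vval v) = vval (nb v)" "sc (vval v) = vval (nc v)"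
  by (cases v; simp)+

lemma involutions [simp]: "sa (sa v) = v" "sb (sb v) = v" "sc (sc v) = v"
  by (cases v; simp)+

lemma linear_reflections: "linear sa" "linear sb" "linear sc"
  by (rule linearI; auto simp: algebra_simps)+

section \<open>Exact verification of the relations on the standard basis\<close>

definition one_num :: num where "one_num = ((1, 0), (0, 0), (0, 0))"
definition zero_num :: num where "zero_num = ((0, 0), (0, 0), (0, 0))"

lemma vec_expand:
  "v = fst v *\<^sub>R vval (one_num, zero_num, zero_num)
     + fst (snd v) *\<^sub>R vval (zero_num, one_num, zero_num)
     + snd (snd v) *\<^sub>R vval (zero_num, zero_num, one_num)"
  by (cases v) (simp add: one_num_def zero_num_def)

lemma linear_eq_id:
  assumes "linear f"
    and "\<And>v. v \<in> {(one_num, zero_num, zero_num), (zero_num, one_num, zero_num),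
      (zero_num, zero_num, one_num)} \<Longrightarrow> f (vval v) = vval v"
  shows "f v = v"
proof -
  define e1 e2 e3 where "e1 = vval (one_num, zero_num, zero_num)"
    and "e2 = vval (zero_num, one_num, zero_num)" and "e3 = vval (zero_num, zero_num, one_num)"
  have v: "v = fst v *\<^sub>R e1 + fst (snd v) *\<^sub>R e2 + snd (snd v) *\<^sub>R e3"
    unfolding e1_def e2_def e3_def by (rule vec_expand)
  have "f (a *\<^sub>R e1 + b *\<^sub>R e2 + c *\<^sub>R e3) = a *\<^sub>R e1 + b *\<^sub>R e2 + c *\<^sub>R e3" for a b c
    by (simp only: linear_add[OF assms(1)] linear_scale[OF assms(1)])
      (simp add: assms(2) e1_def e2_def e3_def del: vval.simps)
  then show ?thesis by (metis v)
qed

text \<open>The product abcacbcbab; permuting the arguments gives its cyclic shifts.\<close>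

definition word :: "('v \<Rightarrow> 'v) \<Rightarrow> ('v \<Rightarrow> 'v) \<Rightarrow> ('v \<Rightarrow> 'v) \<Rightarrow> 'v \<Rightarrow> 'v" where
  "word a b c v = a (b (c (a (c (b (c (b (a (b v)))))))))"

lemma linear_word: "linear a \<Longrightarrow> linear b \<Longrightarrow> linear c \<Longrightarrow> linear (word a b c)"
  unfolding word_def by (intro linearI) (simp_all add: linear_add linear_scale)

lemma word_vval:
  assumes "\<And>v. a (vval v) = vval (a' v)" "\<And>v. b (vval v) = vval (b' v)"
    "\<And>v. c (vval v) = vval (c' v)"
  shows "word a b c (vval v) = vval (word a' b' c' v)"
  by (simp add: word_def assms del: vval.simps)

lemma word_computations:
  assumes "v \<in> {(one_num, zero_num, zero_num), (zero_num, one_num, zero_num),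
    (zero_num, zero_num, one_num)}"
  shows "word na nb nc (word na nb nc v) = v" "word nb nc na (word nb nc na v) = v"
    "word nc na nb (word nc na nb v) = v"
proof -
  let ?e1 = "(one_num, zero_num, zero_num)" and ?e2 = "(zero_num, one_num, zero_num)"
    and ?e3 = "(zero_num, zero_num, one_num)"
  have "word na nb nc (word na nb nc ?e1) = ?e1" "word na nb nc (word na nb nc ?e2) = ?e2"
    "word na nb nc (word na nb nc ?e3) = ?e3" "word nb nc na (word nb nc na ?e1) = ?e1"
    "word nb nc na (word nb nc na ?e2) = ?e2" "word nb nc na (word nb nc na ?e3) = ?e3"
    "word nc na nb (word nc na nb ?e1) = ?e1" "word nc na nb (word nc na nb ?e2) = ?e2"
    "word nc na nb (word nc na nb ?e3) = ?e3"
    unfolding word_def by code_simp+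
  with assms show "word na nb nc (word na nb nc v) = v" "word nb nc na (word nb nc na v) = v"
    "word nc na nb (word nc na nb v) = v"
    by (elim insertE emptyE; simp only:)+
qed

lemma word_involution:
  "word sa sb sc (word sa sb sc v) = v" "word sb sc sa (word sb sc sa v) = v"
  "word sc sa sb (word sc sa sb v) = v"
proof -
  have "word a b c (word a b c v) = v"
    if "linear a" "linear b" "linear c"
      and "\<And>v. a (vval v) = vval (a' v)" "\<And>v. b (vval v) = vval (b' v)"
        "\<And>v. c (vval v) = vval (c' v)"
      and "\<And>v. v \<in> {(one_num, zero_num, zero_num), (zero_num, one_num, zero_num),
        (zero_num, zero_num, one_num)} \<Longrightarrow> word a' b' c' (word a' b' c' v) = v"
    for a b c a' b' c'
  proof (rule linear_eq_id)
    show "linear (\<lambda>v. word a b c (word a b c v))"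
      using linear_compose[OF linear_word linear_word] that(1-3) by (simp add: o_def)
    show "word a b c (word a b c (vval v)) = vval v"
      if "v \<in> {(one_num, zero_num, zero_num), (zero_num, one_num, zero_num),
        (zero_num, zero_num, one_num)}" for v
      unfolding word_vval[of a a' b b' c c', OF \<open>\<And>v. a (vval v) = vval (a' v)\<close>
          \<open>\<And>v. b (vval v) = vval (b' v)\<close> \<open>\<And>v. c (vval v) = vval (c' v)\<close>]
      using \<open>\<And>v. v \<in> _ \<Longrightarrow> word a' b' c' (word a' b' c' v) = v\<close>[OF that] by simp
  qed
  from this[OF linear_reflections vval_reflections word_computations(1)]
    this[OF linear_reflections(2,3,1) vval_reflections(2,3,1) word_computations(2)]
    this[OF linear_reflections(3,1,2) vval_reflections(3,1,2) word_computations(3)]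
  show "word sa sb sc (word sa sb sc v) = v" "word sb sc sa (word sb sc sa v) = v"
    "word sc sa sb (word sc sa sb v) = v"
    by blast+
qed

section \<open>Three reflections and their root basis\<close>

definition r1 :: "vec \<Rightarrow> vec" where "r1 v = sb v"
definition r2 :: "vec \<Rightarrow> vec" where "r2 v = sc (sb (sc v))"
definition r3 :: "vec \<Rightarrow> vec" where "r3 v = sa (sb (r2 (sb (sa v))))"

lemma r_involutions [simp]: "r1 (r1 v) = v" "r2 (r2 v) = v" "r3 (r3 v) = v"
  by (simp_all add: r1_def r2_def r3_def)

lemma linear_r: "linear r1" "linear r2" "linear r3"
  unfolding r1_def r2_def r3_def
  by (intro linearI; simp add: linear_reflections[THEN linear_add] linear_reflections[THEN linear_scale])+

text \<open>
  The roots of \<open>r1\<close>, \<open>r2\<close>, \<open>r3\<close> are \<open>n1\<close>, \<open>- c n1\<close> and \<open>- a b c n1\<close>; the signs make the off-diagonal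
  Cartan entries \<open>m12\<close>, \<open>m13\<close>, \<open>m23\<close> of this new root basis positive. They exceed 2, so that a
  reflection always makes its own coordinate the dominant one.
\<close>

definition n1 :: nvec where
  "n1 = (zero_num, one_num, zero_num)"
definition n2 :: nvec where
  "n2 = (zero_num, nneg one_num, c32)"
definition n3 :: nvec where
  "n3 = (((- 7, 5), (0, - 2), (1, 0)), ((- 2, - 2), (3, 2), (0, - 1)), c32)"

definition m12 :: num where "m12 = ((- 1, - 2), (3, 2), (0, - 1))"
definition m13 :: num where "m13 = ((0, 1), (1, - 1), (0, 0))"
definition m23 :: num where "m23 = ((- 6, 2), (7, - 2), (2, - 2))"

fun nvadd :: "nvec \<Rightarrow> nvec \<Rightarrow> nvec" where
  "nvadd (p, q, r) (p', q', r') = (nadd p p', nadd q q', nadd r r')"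

fun nvscale :: "num \<Rightarrow> nvec \<Rightarrow> nvec" where
  "nvscale m (p, q, r) = (nmul m p, nmul m q, nmul m r)"

lemma vval_nvadd: "vval (nvadd v w) = vval v + vval w"
  by (cases v; cases w) (simp del: nval.simps nadd.simps)

lemma vval_nvscale: "vval (nvscale m v) = nval m *\<^sub>R vval v"
  by (cases v) (simp del: nval.simps nmul.simps)

lemma r_computations:
  "nb n1 = nvscale (nneg one_num) n1"
  "nc (nb (nc n2)) = nvscale (nneg one_num) n2"
  "na (nb (nc (nb (nc (nb (na n3)))))) = nvscale (nneg one_num) n3"
  "nb n2 = nvadd n2 (nvscale m12 n1)"
  "nb n3 = nvadd n3 (nvscale m13 n1)"
  "nc (nb (nc n1)) = nvadd n1 (nvscale m12 n2)"
  "nc (nb (nc n3)) = nvadd n3 (nvscale m23 n2)"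
  "na (nb (nc (nb (nc (nb (na n1)))))) = nvadd n1 (nvscale m13 n3)"
  "na (nb (nc (nb (nc (nb (na n2)))))) = nvadd n2 (nvscale m23 n3)"
  by code_simp+

lemma nval_one_num [simp]: "nval one_num = 1"
  and nval_zero_num [simp]: "nval zero_num = 0"
  by (simp_all add: one_num_def zero_num_def)

lemma r_roots:
  "r1 (vval n1) = - vval n1" "r2 (vval n2) = - vval n2" "r3 (vval n3) = - vval n3"
  "r1 (vval n2) = vval n2 + nval m12 *\<^sub>R vval n1"
  "r1 (vval n3) = vval n3 + nval m13 *\<^sub>R vval n1"
  "r2 (vval n1) = vval n1 + nval m12 *\<^sub>R vval n2"
  "r2 (vval n3) = vval n3 + nval m23 *\<^sub>R vval n2"
  "r3 (vval n1) = vval n1 + nval m13 *\<^sub>R vval n3"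
  "r3 (vval n2) = vval n2 + nval m23 *\<^sub>R vval n3"
  by (simp_all add: r1_def r2_def r3_def vval_reflections r_computations vval_nvadd vval_nvscale
      del: vval.simps)

text \<open>With the monomials enclosed, the later estimates become linear.\<close>

lemma products_bounds:
  "- 1.151 \<le> kappa * xi" "kappa * xi \<le> - 1.149"
  "3.459 \<le> xi ^ 2" "xi ^ 2 \<le> 3.468"
  "- 2.144 \<le> kappa * xi ^ 2" "kappa * xi ^ 2 \<le> - 2.137"
proof -
  have "0.618 * 1.86 \<le> - kappa * xi" by (rule mult_mono; use kappa_bounds xi_bounds in simp)
  then show "kappa * xi \<le> - 1.149" by simp
  have "- kappa * xi \<le> 0.6181 * 1.862" by (rule mult_mono; use kappa_bounds xi_bounds in simp)
  then show "- 1.151 \<le> kappa * xi" by simp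
  have "1.86 * 1.86 \<le> xi * xi" by (rule mult_mono; use xi_bounds in simp)
  then show lower: "3.459 \<le> xi ^ 2" by (simp add: power2_eq_square)
  have "xi * xi \<le> 1.862 * 1.862" by (rule mult_mono; use xi_bounds in simp)
  then show upper: "xi ^ 2 \<le> 3.468" by (simp add: power2_eq_square)
  have "0.618 * 3.459 \<le> - kappa * xi ^ 2" by (rule mult_mono; use kappa_bounds lower in simp)
  then show "kappa * xi ^ 2 \<le> - 2.137" by simp
  have "- kappa * xi ^ 2 \<le> 0.6181 * 3.468" by (rule mult_mono; use kappa_bounds upper in simp)
  then show "- 2.144 \<le> kappa * xi ^ 2" by simp
qed

lemma m_ge: "nval m12 \<ge> 2" "nval m13 \<ge> 2" "nval m23 \<ge> 2"
  using products_bounds kappa_bounds xi_bounds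
  by (simp_all add: m12_def m13_def m23_def algebra_simps)

definition comb :: "real \<Rightarrow> real \<Rightarrow> real \<Rightarrow> vec" where
  "comb x y z = x *\<^sub>R vval n1 + y *\<^sub>R vval n2 + z *\<^sub>R vval n3"

lemma r_comb:
  "r1 (comb x y z) = comb (nval m12 * y + nval m13 * z - x) y z"
  "r2 (comb x y z) = comb x (nval m12 * x + nval m23 * z - y) z"
  "r3 (comb x y z) = comb x y (nval m13 * x + nval m23 * y - z)"
  by (simp_all add: comb_def linear_r[THEN linear_add] linear_r[THEN linear_scale] r_roots
      scaleR_add_left scaleR_add_right scaleR_diff_left mult.commute del: vval.simps)

text \<open>Triangularity: only \<open>n3\<close> has a nonzero first coordinate, and
  \<open>n2\<close>, unlike \<open>n1\<close>, has a nonzero third one.\<close>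

lemma comb_inject: "comb x y z = comb x' y' z' \<longleftrightarrow> x = x' \<and> y = y' \<and> z = z'"
proof
  assume eq: "comb x y z = comb x' y' z'"
  have "nval c32 \<noteq> 0" "nval ((- 7, 5), (0, - 2), (1, 0)) \<noteq> 0"
    using products_bounds kappa_bounds xi_bounds by (auto simp: c32_def algebra_simps)
  with eq show "x = x' \<and> y = y' \<and> z = z'"
    by (auto simp: comb_def n1_def n2_def n3_def simp del: nval.simps)
qed simp

section \<open>Ping-pong on cones\<close>

definition cone1 :: "vec set" where
  "cone1 = {comb x y z | x y z. 0 \<le> y \<and> 0 \<le> z \<and> y < x \<and> z < x}"
definition cone2 :: "vec set" where
  "cone2 = {comb x y z | x y z. 0 \<le> x \<and> 0 \<le> z \<and> x < y \<and> z < y}"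
definition cone3 :: "vec set" where
  "cone3 = {comb x y z | x y z. 0 \<le> x \<and> 0 \<le> y \<and> x < z \<and> y < z}"

lemma cones_disjoint: "cone2 \<inter> cone3 = {}"
  by (auto simp: cone2_def cone3_def comb_inject)

text \<open>The new coordinate is at least 2y + 2z - x, and x is below y or z.\<close>

lemma dominant:
  fixes m n x y z :: real
  assumes "2 \<le> m" "2 \<le> n" "0 \<le> x" "0 \<le> y" "0 \<le> z" "x < y \<or> x < z"
  shows "y < m * y + n * z - x" "z < m * y + n * z - x"
proof -
  have "2 * y \<le> m * y" "2 * z \<le> n * z" using assms by (simp_all add: mult_right_mono)
  note bounds = this assms(3-6)
  from bounds show "y < m * y + n * z - x" by linarith
  from bounds show "z < m * y + n * z - x" by linarith
qed

lemma cone_steps: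
  "v \<in> cone2 \<union> cone3 \<Longrightarrow> r1 v \<in> cone1"
  "v \<in> cone1 \<union> cone3 \<Longrightarrow> r2 v \<in> cone2"
  "v \<in> cone1 \<union> cone2 \<Longrightarrow> r3 v \<in> cone3"
  by (auto simp: cone1_def cone2_def cone3_def r_comb comb_inject intro!: dominant m_ge)

text \<open>All coordinates tie, so no cone contains this point, yet each reflection raises its own
  coordinate to at least 3.\<close>

definition base :: vec where "base = comb 1 1 1"

lemma base_steps: "r1 base \<in> cone1" "r2 base \<in> cone2" "r3 base \<in> cone3"
  using m_ge by (auto simp: base_def cone1_def cone2_def cone3_def r_comb comb_inject)

lemma base_notin_cones: "base \<notin> cone1" "base \<notin> cone2" "base \<notin> cone3"
  by (auto simp: base_def cone1_def cone2_def cone3_def comb_inject)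

fun step :: "bool \<Rightarrow> bool \<Rightarrow> vec \<Rightarrow> vec" where
  "step True True v = r1 (r2 v)"
| "step False True v = r2 (r1 v)"
| "step True False v = r1 (r3 v)"
| "step False False v = r3 (r1 v)"

text \<open>
  The products \<open>r1 r2\<close> and \<open>r1 r3\<close> share their first factor, so a word in them is not always a reduced
  word in the reflections: the extra condition on \<open>r1 v\<close> records what remains after that cancellation.
\<close>

fun region :: "bool \<Rightarrow> bool \<Rightarrow> vec set" where
  "region True True = {v \<in> cone1. r1 v \<in> cone2}"
| "region False True = cone2"
| "region True False = {v \<in> cone1. r1 v \<in> cone3}"
| "region False False = cone3"

lemma region_base: "step e b base \<in> region e b"
  using base_steps cone_steps by (cases e; cases b) auto

lemma region_step: "v \<in> region e b \<Longrightarrow> (e', b') \<noteq> (\<not> e, b) \<Longrightarrow> step e' b' v \<in> region e' b'"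
  using cone_steps by (cases e; cases b; cases e'; cases b') auto

lemma base_notin_region: "base \<notin> region e b"
  using base_notin_cones by (cases e; cases b) auto

lemma ping_pong:
  assumes "reduced w" "snd ` set w \<subseteq> {U, V}" "w \<noteq> []"
  shows "foldr (\<lambda>l. step (fst l) (snd l = U)) w base \<in> region (fst (hd w)) (snd (hd w) = U)"
  using assms
proof (induction w)
  case (Cons l w)
  show ?case
  proof (cases w)
    case Nil
    then show ?thesis by (simp add: region_base)
  next
    case w: (Cons m w')
    have "m \<noteq> inv_letter l" using Cons.prems(1) w by simp
    \<comment> \<open>Both generators lie in {U, V}, so equality with \<open>U\<close> tells them
      apart; a forbidden pair of steps would come from inverse letters.\<close>
    then have "(fst l, snd l = U) \<noteq> (\<not> fst m, snd m = U)"
      using Cons.prems(2) w by (cases l; cases m) (auto simp: inv_letter_def)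
    moreover have "foldr (\<lambda>l. step (fst l) (snd l = U)) w base \<in> region (fst m) (snd m = U)"
      using Cons.IH Cons.prems w by (auto dest: reduced_tl)
    ultimately show ?thesis using region_step w by simp
  qed
qed simp

section \<open>Words and actions\<close>

locale word_action =
  fixes \<rho> :: "bool \<times> 'a \<Rightarrow> 's \<Rightarrow> 's"
  assumes inv_letter_act [simp]: "\<rho> (inv_letter l) (\<rho> l s) = s"
begin

definition act :: "'a word \<Rightarrow> 's \<Rightarrow> 's" where
  "act w s = foldr \<rho> w s"

lemma act_simps [simp]: "act [] s = s" "act (l # w) s = \<rho> l (act w s)"
  by (simp_all add: act_def)

lemma act_append [simp]: "act (u @ v) s = act u (act v s)"
  by (simp add: act_def)

lemma act_push: "act (push l w) s = \<rho> l (act w s)"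
proof (cases w)
  case (Cons m v)
  then show ?thesis using inv_letter_act[of "inv_letter l"] by auto
qed simp

lemma act_free_reduce [simp]: "act (free_reduce w) s = act w s"
  unfolding free_reduce_def by (induction w) (simp_all add: act_push)

lemma act_mult [simp]: "act (u \<otimes>\<^bsub>free_group X\<^esub> v) s = act u (act v s)"
  by (simp add: free_group_def)

lemma act_one [simp]: "act \<one>\<^bsub>free_group X\<^esub> s = s"
  by (simp add: free_group_def)

lemma act_pow [simp]: "act (u [^]\<^bsub>free_group X\<^esub> (n::nat)) s = (act u ^^ n) s"
  by (induction n arbitrary: s) (simp_all add: nat_pow_def funpow_swap1)

lemma act_inv:
  assumes "u \<in> carrier (free_group X)"
  shows "act (inv\<^bsub>free_group X\<^esub> u) (act u s) = s" "act u (act (inv\<^bsub>free_group X\<^esub> u) s) = s"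
  using group.l_inv[OF group_free_group assms] group.r_inv[OF group_free_group assms]
  by (metis act_mult act_one)+

lemma normal_kernel: "{w \<in> carrier (free_group X). \<forall>s. act w s = s} \<lhd> free_group X"
proof -
  interpret group "free_group X" by (rule group_free_group)
  show ?thesis
  proof (rule normal_invI)
    show "subgroup {w \<in> carrier (free_group X). \<forall>s. act w s = s} (free_group X)"
      by (rule subgroupI) (auto intro: exI[of _ "\<one>\<^bsub>free_group X\<^esub>"], metis act_inv(1))
  qed (auto simp: act_inv)
qed

text \<open>The kernel of the action is one of the normal subgroups being intersected.\<close>

lemma act_normal_closure:
  assumes "R \<subseteq> carrier (free_group X)" "\<And>w s. w \<in> R \<Longrightarrow> act w s = s"
    and "w \<in> normal_closure (free_group X) R"
  shows "act w s = s"
  using assms normal_kernel[of X] unfolding normal_closure_def by blast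

end

section \<open>Evaluation of words in a group\<close>

context group
begin

definition eval_letter :: "bool \<times> 'a \<Rightarrow> 'a" where
  "eval_letter l = (if fst l then snd l else inv (snd l))"

definition eval :: "'a word \<Rightarrow> 'a" where
  "eval w = foldr (\<lambda>l g. eval_letter l \<otimes> g) w \<one>"

lemma eval_simps [simp]: "eval [] = \<one>" "eval (l # w) = eval_letter l \<otimes> eval w"
  by (simp_all add: eval_def)

lemma eval_letter_closed [simp]: "snd l \<in> carrier G \<Longrightarrow> eval_letter l \<in> carrier G"
  by (simp add: eval_letter_def)

lemma eval_closed [simp]: "snd ` set w \<subseteq> carrier G \<Longrightarrow> eval w \<in> carrier G"
  by (induction w) auto

lemma eval_letter_inv: "snd l \<in> carrier G \<Longrightarrow> eval_letter (inv_letter l) = inv (eval_letter l)"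
  by (simp add: eval_letter_def inv_letter_def)

lemma eval_push:
  "snd l \<in> carrier G \<Longrightarrow> snd ` set w \<subseteq> carrier G \<Longrightarrow> eval (push l w) = eval_letter l \<otimes> eval w"
  by (cases w) (auto simp: eval_letter_inv m_assoc[symmetric])

lemma eval_foldr_push:
  "snd ` set u \<subseteq> carrier G \<Longrightarrow> snd ` set v \<subseteq> carrier G \<Longrightarrow>
    eval (foldr push u v) = eval u \<otimes> eval v"
proof (induction u)
  case (Cons l u)
  have "snd ` set (foldr push u v) \<subseteq> carrier G"
    using letters_foldr_push[of u v] Cons.prems by fastforce
  with Cons show ?case by (simp add: eval_push m_assoc)
qed simp

lemma eval_hom:
  assumes "X \<subseteq> carrier G"
  shows "eval \<in> hom (free_group X) G"
proof (rule homI)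
  fix u v assume "u \<in> carrier (free_group X)" "v \<in> carrier (free_group X)"
  then show "eval (u \<otimes>\<^bsub>free_group X\<^esub> v) = eval u \<otimes> eval v"
    using assms by (auto simp: free_group_def free_reduce_append intro!: eval_foldr_push)
qed (use assms in \<open>auto simp: free_group_def\<close>)

text \<open>The hypothesis \<open>free\<close> says that \<open>eval\<close> has trivial kernel, so
  it is an isomorphism onto its image.\<close>

lemma free_subgroup:
  assumes X: "X \<subseteq> carrier G"
    and free: "\<And>w. reduced w \<Longrightarrow> snd ` set w \<subseteq> X \<Longrightarrow> w \<noteq> [] \<Longrightarrow> eval w \<noteq> \<one>"
  defines "H \<equiv> eval ` carrier (free_group X)"
  shows "subgroup H G" "is_free_group (G\<lparr>carrier := H\<rparr>)"
proof -
  interpret F: group_hom "free_group X" G eval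
    by (intro group_hom.intro group_hom_axioms.intro group_free_group is_group eval_hom X)
  show sub: "subgroup H G"
    unfolding H_def by (rule F.img_is_subgroup)
  have "inj_on eval (carrier (free_group X))"
    by (rule F.inj_on_one_iff[THEN iffD2]) (use free in \<open>auto simp: free_group_def\<close>)
  then have "eval \<in> iso (free_group X) (G\<lparr>carrier := H\<rparr>)"
    using eval_hom[OF X] by (auto simp: iso_def hom_def bij_betw_def H_def)
  then show "is_free_group (G\<lparr>carrier := H\<rparr>)"
    unfolding is_free_group_def is_iso_def
    using subgroup.subgroup_is_group[OF sub is_group] by blast
qed

end

section \<open>The action of the group\<close>

type_synonym state = "vec \<times> vec \<times> vec"

text \<open>The representation of the index three subgroup generated by \<open>x\<close>, \<open>y x y\<^sup>-\<^sup>1\<close>,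
  \<open>y\<^sup>-\<^sup>1 x y\<close>, induced to the whole group.\<close>

fun letter_act :: "bool \<times> generator \<Rightarrow> state \<Rightarrow> state" where
  "letter_act (b, Gen_x) (p, q, r) = (sa p, sb q, sc r)"
| "letter_act (True, Gen_y) (p, q, r) = (q, r, p)"
| "letter_act (False, Gen_y) (p, q, r) = (r, p, q)"

interpretation word_action letter_act
proof
  fix l s show "letter_act (inv_letter l) (letter_act l s) = s"
    by (cases "(l, s)" rule: letter_act.cases) (auto simp: inv_letter_def)
qed

text \<open>Moving the powers of y to the right turns the root of the long relator into abcacbcbab,
  times y^15. On the three components it acts by the three cyclic shifts.\<close>

lemma relators_act: "w \<in> relators \<Longrightarrow> act w s = s"
  using word_involution[unfolded word_def]
  by (cases s rule: prod_cases3)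
    (auto simp: relators_def Let_def gen_def numeral_eq_Suc simp del: sa.simps sb.simps sc.simps)

abbreviation F :: "generator word monoid" where
  "F \<equiv> free_group UNIV"

definition N :: "generator word set" where
  "N = normal_closure F relators"

lemma N_normal: "N \<lhd> F"
  unfolding N_def by (intro group.normal_closure_normal group_free_group relators_in_carrier)

lemma Gxy_def': "Gxy = F Mod N"
  by (simp add: Gxy_def presented_group_def N_def)

lemma N_act: "w \<in> N \<Longrightarrow> act w s = s"
  unfolding N_def by (rule act_normal_closure[OF relators_in_carrier relators_act])

definition coset_act :: "generator word set \<Rightarrow> state \<Rightarrow> state" where
  "coset_act C = act (SOME w. w \<in> C)"

text \<open>Representatives differ by elements of \<open>N\<close>, which act trivially, so the
  choice is immaterial.\<close>

lemma coset_act_rcoset: "u \<in> carrier F \<Longrightarrow> coset_act (N #>\<^bsub>F\<^esub> u) s = act u s"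
proof -
  assume u: "u \<in> carrier F"
  interpret group F by (rule group_free_group)
  have "u \<in> N #>\<^bsub>F\<^esub> u" by (rule rcos_self[OF u normal_imp_subgroup[OF N_normal]])
  then have "(SOME w. w \<in> N #>\<^bsub>F\<^esub> u) \<in> N #>\<^bsub>F\<^esub> u" by (rule someI)
  then obtain n where "n \<in> N" "(SOME w. w \<in> N #>\<^bsub>F\<^esub> u) = n \<otimes>\<^bsub>F\<^esub> u"
    by (auto simp: r_coset_def)
  then show ?thesis by (simp add: coset_act_def N_act)
qed

interpretation G: group Gxy by (rule group_Gxy)

lemma carrier_Gxy: "C \<in> carrier Gxy \<longleftrightarrow> (\<exists>u \<in> carrier F. C = N #>\<^bsub>F\<^esub> u)"
  by (auto simp: Gxy_def' FactGroup_def RCOSETS_def)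

lemma coset_act_mult:
  assumes "C \<in> carrier Gxy" "D \<in> carrier Gxy"
  shows "coset_act (C \<otimes>\<^bsub>Gxy\<^esub> D) s = coset_act C (coset_act D s)"
proof -
  obtain u v where uv: "u \<in> carrier F" "v \<in> carrier F" "C = N #>\<^bsub>F\<^esub> u" "D = N #>\<^bsub>F\<^esub> v"
    using assms by (auto simp: carrier_Gxy)
  have "C \<otimes>\<^bsub>Gxy\<^esub> D = N #>\<^bsub>F\<^esub> (u \<otimes>\<^bsub>F\<^esub> v)"
    using uv by (simp add: Gxy_def' FactGroup_def normal.rcos_sum[OF N_normal])
  then show ?thesis
    using uv group.is_monoid[OF group_free_group, THEN monoid.m_closed, of u UNIV v]
    by (simp add: coset_act_rcoset)
qed

lemma coset_act_one: "coset_act \<one>\<^bsub>Gxy\<^esub> s = s"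
proof -
  have "\<one>\<^bsub>Gxy\<^esub> = N #>\<^bsub>F\<^esub> \<one>\<^bsub>F\<^esub>"
    using group.coset_mult_one[OF group_free_group, of N] normal_imp_subgroup[OF N_normal]
    by (simp add: Gxy_def' FactGroup_def subgroup.subset)
  moreover have "\<one>\<^bsub>F\<^esub> \<in> carrier F" by (simp add: free_group_def)
  ultimately show ?thesis by (simp add: coset_act_rcoset)
qed

section \<open>The two free generators\<close>

definition word_b :: "generator word" where
  "word_b = [(True, Gen_y), (True, Gen_x), (False, Gen_y)]"

definition word_c :: "generator word" where
  "word_c = [(False, Gen_y), (True, Gen_x), (True, Gen_y)]"

text \<open>\<open>word_u\<close> spells \<open>r1 r2\<close> = b(cbc), and \<open>word_v\<close>
  spells \<open>r1 r3\<close> = b(abcbcba).\<close>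

definition word_u :: "generator word" where
  "word_u = word_b @ word_c @ word_b @ word_c"

definition word_v :: "generator word" where
  "word_v = word_b @ gen Gen_x @ word_b @ word_c @ word_b @ word_c @ word_b @ gen Gen_x"

lemma words_carrier: "word_u \<in> carrier F" "word_v \<in> carrier F"
  by (simp_all add: free_group_def word_u_def word_v_def word_b_def word_c_def gen_def inv_letter_def)

lemma words_act: "fst (act word_u s) = r1 (r2 (fst s))" "fst (act word_v s) = r1 (r3 (fst s))"
  by (cases s rule: prod_cases3;
      simp add: word_u_def word_v_def word_b_def word_c_def gen_def r1_def r2_def r3_def
        del: sa.simps sb.simps sc.simps)+

definition U where "U = N #>\<^bsub>F\<^esub> word_u"
definition V where "V = N #>\<^bsub>F\<^esub> word_v"

lemma UV_carrier: "U \<in> carrier Gxy" "V \<in> carrier Gxy"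
  using words_carrier by (auto simp: U_def V_def carrier_Gxy)

lemma UV_act: "fst (coset_act U s) = r1 (r2 (fst s))" "fst (coset_act V s) = r1 (r3 (fst s))"
  by (simp_all add: U_def V_def coset_act_rcoset words_carrier words_act)

lemma U_neq_V: "U \<noteq> V"
proof
  assume "U = V"
  then have "r1 (r2 base) = r1 (r3 base)"
    using UV_act[of "(base, base, base)"] by simp
  then have "r2 base = r3 base" by (metis r_involutions(1))
  then show False using base_steps cones_disjoint by auto
qed

lemma eval_letter_act:
  assumes "snd l \<in> {U, V}"
  shows "fst (coset_act (G.eval_letter l) s) = step (fst l) (snd l = U) (fst s)"
proof -
  define g where "g = snd l"
  have g: "g \<in> carrier Gxy" using assms UV_carrier by (auto simp: g_def)
  have act_g: "fst (coset_act g s) = step True (g = U) (fst s)" for s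
  proof (cases "g = U")
    case True
    then show ?thesis by (simp only: UV_act step.simps simp_thms)
  next
    case False
    then have "g = V" using assms by (simp add: g_def)
    with False show ?thesis by (simp only: UV_act step.simps simp_thms)
  qed
  have undo: "step False b (step True b v) = v" for b v
    by (cases b) simp_all
  show ?thesis
  proof (cases "fst l")
    case True
    then show ?thesis using act_g by (simp add: G.eval_letter_def g_def)
  next
    case False
    \<comment> \<open>The inverse is handled by cancellation: \<open>g\<close> carries
      \<open>t\<close> back to \<open>s\<close>.\<close>
    define t where "t = coset_act (inv\<^bsub>Gxy\<^esub> g) s"
    have "coset_act g t = s"
      using coset_act_mult[OF g G.inv_closed[OF g], of s] g by (simp add: t_def coset_act_one)
    then have "fst s = step True (g = U) (fst t)" using act_g[of t] by simp
    then have "fst t = step False (g = U) (fst s)" by (simp only: undo)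
    then show ?thesis using False by (simp add: G.eval_letter_def t_def g_def)
  qed
qed

lemma eval_act:
  assumes "snd ` set w \<subseteq> {U, V}"
  shows "fst (coset_act (G.eval w) s) = foldr (\<lambda>l. step (fst l) (snd l = U)) w (fst s)"
  using assms
proof (induction w)
  case (Cons l w)
  have "snd l \<in> carrier Gxy" "snd ` set w \<subseteq> carrier Gxy"
    using Cons.prems UV_carrier by auto
  with Cons show ?case by (simp add: coset_act_mult eval_letter_act)
qed (simp add: coset_act_one)

lemma eval_neq_one:
  assumes "reduced w" "snd ` set w \<subseteq> {U, V}" "w \<noteq> []"
  shows "G.eval w \<noteq> \<one>\<^bsub>Gxy\<^esub>"
proof
  assume "G.eval w = \<one>\<^bsub>Gxy\<^esub>"
  then have "foldr (\<lambda>l. step (fst l) (snd l = U)) w base = base"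
    using eval_act[OF assms(2), of "(base, base, base)"] by (simp add: coset_act_one)
  then show False using ping_pong[OF assms] base_notin_region by metis
qed

theorem theorem2:
  shows "\<exists>H. subgroup H Gxy \<and> is_free_group (Gxy\<lparr>carrier := H\<rparr>) \<and> \<not> comm_group (Gxy\<lparr>carrier := H\<rparr>)"
proof (intro exI conjI)
  let ?H = "G.eval ` carrier (free_group {U, V})"
  have X: "{U, V} \<subseteq> carrier Gxy" using UV_carrier by simp
  show "subgroup ?H Gxy" "is_free_group (Gxy\<lparr>carrier := ?H\<rparr>)"
    by (rule G.free_subgroup[OF X]; use eval_neq_one in blast)+
  show "\<not> comm_group (Gxy\<lparr>carrier := ?H\<rparr>)"
  proof
    assume comm: "comm_group (Gxy\<lparr>carrier := ?H\<rparr>)"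
    have mem: "G.eval [(True, g)] \<in> ?H" if "g \<in> {U, V}" for g
      using that by (intro imageI) (simp add: free_group_def)
    then have "U \<in> ?H" "V \<in> ?H"
      using mem[of U] mem[of V] UV_carrier by (simp_all add: G.eval_letter_def)
    then have UV: "U \<otimes>\<^bsub>Gxy\<^esub> V = V \<otimes>\<^bsub>Gxy\<^esub> U"
      using comm_monoid.m_comm[OF comm_group.axioms(1)[OF comm], of U V] by simp
    \<comment> \<open>The commutator is a nonempty reduced word because U and V differ, so it cannot
      evaluate to 1.\<close>
    have "G.eval [(True, U), (True, V), (False, U), (False, V)]
        = U \<otimes>\<^bsub>Gxy\<^esub> V \<otimes>\<^bsub>Gxy\<^esub> inv\<^bsub>Gxy\<^esub> (V \<otimes>\<^bsub>Gxy\<^esub> U)"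
      using UV_carrier by (simp add: G.eval_letter_def G.inv_mult_group G.m_assoc)
    also have "\<dots> = \<one>\<^bsub>Gxy\<^esub>" using UV UV_carrier by simp
    finally show False
      using eval_neq_one[of "[(True, U), (True, V), (False, U), (False, V)]"] U_neq_V
      by (simp add: inv_letter_def)
  qed
qed

end
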